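(* Assume $f:H\to H$ admits a power series representation $$f(q) := g(\tilde q) := \sum_{n=-\infty}^{\infty} a_n\,\tilde q^{\,n}\qquad\text{for } R_1\le |\tilde q|\le R_2,$$ with each $a_n$ a quaternion constant, $\tilde q = q-q_0$ where $q_0$ is a constant quaternion, and $R_1,R_2>0$ some constants. Then $$\frac{\partial f(q)}{\partial q} = \frac12\Big[f'(q) + \big(g(\tilde q)-g(\tilde q^* )\big)(\tilde q-\tilde q^* )^{-1}\Big],$$ where $f'(q)$ is the derivative in the usual sense, i.e., $$f'(q):=\sum_{n=-\infty}^{\infty} n\,a_n\,\tilde q^{\,n-1}=\sum_{n=-\infty}^{\infty} n\,a_n\,(q-q_0)^{n-1}.$$
   Context: $H$ denotes the non-commutative real algebra of quaternions $q=q_a+q_bi+q_cj+q_dk$ ($q_a,q_b,q_c,q_d\in\mathbb{R}$), with conjugate $q^*=q_a-q_bi-q_cj-q_dk$ and $|q|^2=qq^*$. A function $f:H\to H$ is viewed as a function of the four real variables $q_a,q_b,q_c,q_d$, with quaternion-valued partial derivatives $\partial f/\partial q_a,\dots,\partial f/\partial q_d$. The (left) restricted HR derivative of $f$ with respect to $q$ is $$\frac{\partial f}{\partial q}:=\frac14\left(\frac{\partial f}{\partial q_a}-\frac{\partial f}{\partial q_b}i-\frac{\partial f}{\partial q_c}j-\frac{\partial f}{\partial q_d}k\right).$$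
   Formalization: The formula is proved for R_1 < |q̃| < R_2 and q̃ ≠ q̃*: at real q̃ the inverse (q̃−q̃* )^{-1} is undefined, and on |q̃| = R_1 or R_2 the partial derivatives of f need not exist, since f is arbitrary outside the annulus. *)

theory Defs
  imports "HOL-Analysis.Analysis"
begin

section \<open>Quaternions\<close>

codatatype quat = Quat (Qa: real) (Qb: real) (Qc: real) (Qd: real)

lemma quat_eq_iff: "p = q \<longleftrightarrow> Qa p = Qa q \<and> Qb p = Qb q \<and> Qc p = Qc q \<and> Qd p = Qd q"
  using quat.expand by auto

instantiation quat :: "{zero, one, plus, minus, uminus, times, scaleR, inverse}"
begin

primcorec zero_quat where
  "Qa 0 = 0" | "Qb 0 = 0" | "Qc 0 = 0" | "Qd 0 = 0"

primcorec one_quat where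
  "Qa 1 = 1" | "Qb 1 = 0" | "Qc 1 = 0" | "Qd 1 = 0"

primcorec plus_quat where
  "Qa (p + q) = Qa p + Qa q"
| "Qb (p + q) = Qb p + Qb q"
| "Qc (p + q) = Qc p + Qc q"
| "Qd (p + q) = Qd p + Qd q"

primcorec minus_quat where
  "Qa (p - q) = Qa p - Qa q"
| "Qb (p - q) = Qb p - Qb q"
| "Qc (p - q) = Qc p - Qc q"
| "Qd (p - q) = Qd p - Qd q"

primcorec uminus_quat where
  "Qa (- q) = - Qa q" | "Qb (- q) = - Qb q" | "Qc (- q) = - Qc q" | "Qd (- q) = - Qd q"

primcorec times_quat where
  "Qa (p * q) = Qa p * Qa q - Qb p * Qb q - Qc p * Qc q - Qd p * Qd q"
| "Qb (p * q) = Qa p * Qb q + Qb p * Qa q + Qc p * Qd q - Qd p * Qc q"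
| "Qc (p * q) = Qa p * Qc q - Qb p * Qd q + Qc p * Qa q + Qd p * Qb q"
| "Qd (p * q) = Qa p * Qd q + Qb p * Qc q - Qc p * Qb q + Qd p * Qa q"

primcorec scaleR_quat where
  "Qa (r *\<^sub>R q) = r * Qa q"
| "Qb (r *\<^sub>R q) = r * Qb q"
| "Qc (r *\<^sub>R q) = r * Qc q"
| "Qd (r *\<^sub>R q) = r * Qd q"

primcorec inverse_quat where
  "Qa (inverse q) = Qa q / ((Qa q)\<^sup>2 + (Qb q)\<^sup>2 + (Qc q)\<^sup>2 + (Qd q)\<^sup>2)"
| "Qb (inverse q) = - Qb q / ((Qa q)\<^sup>2 + (Qb q)\<^sup>2 + (Qc q)\<^sup>2 + (Qd q)\<^sup>2)"
| "Qc (inverse q) = - Qc q / ((Qa q)\<^sup>2 + (Qb q)\<^sup>2 + (Qc q)\<^sup>2 + (Qd q)\<^sup>2)"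
| "Qd (inverse q) = - Qd q / ((Qa q)\<^sup>2 + (Qb q)\<^sup>2 + (Qc q)\<^sup>2 + (Qd q)\<^sup>2)"

definition divide_quat :: "quat \<Rightarrow> quat \<Rightarrow> quat" where
  "divide_quat p q = p * inverse q"

instance ..

end

instance quat :: real_algebra_1
  by standard (auto simp: quat_eq_iff algebra_simps)

lemma quat_sum_squares_eq_0_iff:
  "(Qa q)\<^sup>2 + (Qb q)\<^sup>2 + (Qc q)\<^sup>2 + (Qd q)\<^sup>2 = 0 \<longleftrightarrow> q = 0"
  by (auto simp: quat_eq_iff add_nonneg_eq_0_iff)

instance quat :: real_div_algebra
proof
  fix p q :: quat
  show "inverse q * q = 1" "q * inverse q = 1" if "q \<noteq> 0"
  proof -
    define N where "N = (Qa q)\<^sup>2 + (Qb q)\<^sup>2 + (Qc q)\<^sup>2 + (Qd q)\<^sup>2"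
    have N: "N \<noteq> 0"
      using that quat_sum_squares_eq_0_iff[of q] by (simp add: N_def)
    have one: "Qa q * Qa q / N + Qb q * Qb q / N + Qc q * Qc q / N + Qd q * Qd q / N = 1"
      using N by (simp add: N_def power2_eq_square flip: add_divide_distrib)
    show "inverse q * q = 1" "q * inverse q = 1"
      using one by (auto simp: quat_eq_iff mult.commute simp flip: N_def)
  qed
  show "inverse (0 :: quat) = 0"
    by (simp add: quat_eq_iff)
  show "p div q = p * inverse q"
    by (simp add: divide_quat_def)
qed

instantiation quat :: real_inner
begin

definition "inner p q = Qa p * Qa q + Qb p * Qb q + Qc p * Qc q + Qd p * Qd q"

definition "norm (q::quat) = sqrt ((Qa q)\<^sup>2 + (Qb q)\<^sup>2 + (Qc q)\<^sup>2 + (Qd q)\<^sup>2)"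

definition "sgn (q::quat) = q /\<^sub>R norm q"

definition "dist p (q::quat) = norm (p - q)"

definition [code del]:
  "(uniformity :: (quat \<times> quat) filter) = (INF e\<in>{0 <..}. principal {(x, y). dist x y < e})"

definition [code del]:
  "open (U :: quat set) \<longleftrightarrow> (\<forall>x\<in>U. eventually (\<lambda>(x', y). x' = x \<longrightarrow> y \<in> U) uniformity)"

instance
proof
  fix p q r :: quat and x :: real
  show "dist p q = norm (p - q)"
    by (rule dist_quat_def)
  show "sgn p = p /\<^sub>R norm p"
    by (rule sgn_quat_def)
  show "(uniformity :: (quat \<times> quat) filter) = (INF e\<in>{0 <..}. principal {(x, y). dist x y < e})"
    by (rule uniformity_quat_def)
  show "open U \<longleftrightarrow> (\<forall>x\<in>U. eventually (\<lambda>(x', y). x' = x \<longrightarrow> y \<in> U) uniformity)" for U :: "quat set"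
    by (rule open_quat_def)
  show "inner p q = inner q p"
    by (simp add: inner_quat_def mult.commute)
  show "inner (p + q) r = inner p r + inner q r" "inner (x *\<^sub>R p) q = x * inner p q"
    by (simp_all add: inner_quat_def algebra_simps)
  show "0 \<le> inner p p"
    by (simp add: inner_quat_def)
  show "inner p p = 0 \<longleftrightarrow> p = 0"
    using quat_sum_squares_eq_0_iff[of p] by (simp add: inner_quat_def power2_eq_square)
  show "norm p = sqrt (inner p p)"
    by (simp add: norm_quat_def inner_quat_def power2_eq_square)
qed

end

instance quat :: real_normed_div_algebra
proof
  fix p q :: quat
  show "norm (p * q) = norm p * norm q"
    by (simp add: norm_quat_def power2_eq_square algebra_simps flip: real_sqrt_mult)
qed

definition quat_i :: quat ("\<i>\<^sub>q") where "quat_i = Quat 0 1 0 0"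
definition quat_j :: quat ("\<j>\<^sub>q") where "quat_j = Quat 0 0 1 0"
definition quat_k :: quat ("\<k>\<^sub>q") where "quat_k = Quat 0 0 0 1"

lemma quat_units:
  "\<i>\<^sub>q * \<i>\<^sub>q = -1" "\<j>\<^sub>q * \<j>\<^sub>q = -1" "\<k>\<^sub>q * \<k>\<^sub>q = -1"
  "\<i>\<^sub>q * \<j>\<^sub>q = \<k>\<^sub>q" "\<j>\<^sub>q * \<k>\<^sub>q = \<i>\<^sub>q" "\<k>\<^sub>q * \<i>\<^sub>q = \<j>\<^sub>q"
  "\<j>\<^sub>q * \<i>\<^sub>q = - \<k>\<^sub>q" "\<k>\<^sub>q * \<j>\<^sub>q = - \<i>\<^sub>q" "\<i>\<^sub>q * \<k>\<^sub>q = - \<j>\<^sub>q"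
  by (simp_all add: quat_eq_iff quat_i_def quat_j_def quat_k_def)

lemma quat_decomp: "q = Qa q *\<^sub>R 1 + Qb q *\<^sub>R \<i>\<^sub>q + Qc q *\<^sub>R \<j>\<^sub>q + Qd q *\<^sub>R \<k>\<^sub>q"
  by (simp add: quat_eq_iff quat_i_def quat_j_def quat_k_def)

primcorec qcnj :: "quat \<Rightarrow> quat" where
  "Qa (qcnj q) = Qa q"
| "Qb (qcnj q) = - Qb q"
| "Qc (qcnj q) = - Qc q"
| "Qd (qcnj q) = - Qd q"

lemma mult_qcnj: "q * qcnj q = of_real ((norm q)\<^sup>2)"
  by (simp add: quat_eq_iff norm_quat_def of_real_def power2_eq_square)


section \<open>The left restricted HR derivative\<close>

text \<open>
  The partial derivatives of \<open>f\<close> with respect to the four real coordinates of its argument are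
  the derivatives along the directions \<open>1\<close>, \<open>\<i>\<^sub>q\<close>, \<open>\<j>\<^sub>q\<close>, \<open>\<k>\<^sub>q\<close>. Since \<^const>\<open>vector_derivative\<close>
  is an arbitrary value where no derivative exists, existence is a separate predicate.
\<close>

definition qpartial :: "quat \<Rightarrow> (quat \<Rightarrow> quat) \<Rightarrow> quat \<Rightarrow> quat" where
  "qpartial u f q = vector_derivative (\<lambda>t. f (q + t *\<^sub>R u)) (at 0)"

definition has_qpartials :: "(quat \<Rightarrow> quat) \<Rightarrow> quat \<Rightarrow> bool" where
  "has_qpartials f q \<longleftrightarrow>
     (\<forall>u\<in>{1, \<i>\<^sub>q, \<j>\<^sub>q, \<k>\<^sub>q}. (\<lambda>t::real. f (q + t *\<^sub>R u)) differentiable (at 0))"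

definition HR_deriv :: "(quat \<Rightarrow> quat) \<Rightarrow> quat \<Rightarrow> quat" where
  "HR_deriv f q = (1/4) *\<^sub>R
     (qpartial 1 f q - qpartial \<i>\<^sub>q f q * \<i>\<^sub>q - qpartial \<j>\<^sub>q f q * \<j>\<^sub>q - qpartial \<k>\<^sub>q f q * \<k>\<^sub>q)"


section \<open>Two-sided series\<close>

text \<open>
  As usual for Laurent series, a series over all integers converges iff its parts with
  nonnegative and with negative indices both converge (not necessarily absolutely).
\<close>

definition bi_summable :: "(int \<Rightarrow> 'a::real_normed_vector) \<Rightarrow> bool" where
  "bi_summable u \<longleftrightarrow> summable (\<lambda>n. u (int n)) \<and> summable (\<lambda>n. u (- int (Suc n)))"

definition bi_suminf :: "(int \<Rightarrow> 'a::real_normed_vector) \<Rightarrow> 'a" where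
  "bi_suminf u = (\<Sum>n. u (int n)) + (\<Sum>n. u (- int (Suc n)))"

end

theory Submission
  imports Defs
begin

text \<open>
  The whole formula rests on one identity: for every quaternion \<open>s\<close>,
  \<open>s - \<i>\<^sub>q s \<i>\<^sub>q - \<j>\<^sub>q s \<j>\<^sub>q - \<k>\<^sub>q s \<k>\<^sub>q = 4 Re s = 2 (s + s\<^sup>*)\<close>.
  By the noncommutative Leibniz rule, the derivative of \<open>z\<^sup>n\<close> in direction \<open>h\<close> is the sum of
  \<open>z\<^sup>k h z\<^sup>l\<close> over \<open>k + l = n - 1\<close>, and by the identity (applied with \<open>s = z\<^sup>l\<close>) the HR derivative
  turns each summand into \<open>\<onehalf> z\<^sup>k (z\<^sup>l + z\<^sup>*\<^sup>l)\<close>. The first halves add up to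
  half the usual derivative. In the second halves \<open>z\<close> and \<open>z\<^sup>*\<close> commute, so these are half a geometric
  sum with value \<open>(z\<^sup>n - z\<^sup>*\<^sup>n) (z - z\<^sup>*)\<^sup>-\<^sup>1\<close>. This is
  \<open>HR_part_power_deriv\<close>. Left coefficients pass through the HR derivative, since it multiplies by the
  units on the right.

  For the principal part, \<open>w = z\<^sup>-\<^sup>1\<close> has derivative \<open>- w h w\<close>, and the chain rule gives summands of the
  same shape, \<open>- w\<^sup>k h w\<^sup>l\<close> with \<open>k + l = n + 1\<close> and \<open>k, l > 0\<close>, to which the same argument applies
  (\<open>HR_part_power_deriv_inverse\<close>).

  What remains is analysis. Convergence at a single point of norm \<open>R2\<close> bounds the coefficients of the
  regular part, which makes the series of derivatives converge uniformly on smaller balls, so that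
  it can be differentiated term by term (\<open>has_derivative_power_series_noncomm\<close>). The principal
  part is a power series in \<open>w\<close>, for which convergence at a point of norm \<open>R1\<close> plays the same role.
\<close>

section \<open>Termwise differentiation of power series in a Banach algebra\<close>

text \<open>
  The Leibniz derivative of \<open>w\<^sup>n\<close> in direction \<open>h\<close>: one factor \<open>w\<close> at a time is replaced by \<open>h\<close>, in
  place, because \<open>h\<close> need not commute with \<open>w\<close>.
\<close>

definition power_deriv :: "nat \<Rightarrow> 'a::real_algebra_1 \<Rightarrow> 'a \<Rightarrow> 'a" where
  "power_deriv n w h = (\<Sum>k<n. w ^ k * h * w ^ (n - 1 - k))"

lemma power_deriv_0 [simp]: "power_deriv 0 w h = 0"
  by (simp add: power_deriv_def)

lemma power_deriv_Suc: "power_deriv (Suc n) w h = w ^ n * h + power_deriv n w h * w"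
proof -
  have "(\<Sum>k<n. w ^ k * h * w ^ (n - k)) = (\<Sum>k<n. w ^ k * h * w ^ (n - 1 - k) * w)"
  proof (rule sum.cong)
    fix k assume "k \<in> {..<n}"
    then have "n - k = Suc (n - 1 - k)" by auto
    then show "w ^ k * h * w ^ (n - k) = w ^ k * h * w ^ (n - 1 - k) * w"
      by (simp only: power_Suc2 mult.assoc)
  qed simp
  then show ?thesis
    by (simp add: power_deriv_def sum_distrib_right)
qed

lemma has_derivative_power_noncomm:
  fixes w :: "'a::real_normed_algebra_1"
  shows "((\<lambda>w. w ^ n) has_derivative power_deriv n w) (at w within S)"
proof (induction n)
  case 0
  show ?case by (simp add: power_deriv_def[abs_def])
next
  case (Suc n)
  have "((\<lambda>w. w ^ n * w) has_derivative (\<lambda>h. w ^ n * h + power_deriv n w h * w)) (at w within S)"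
    by (rule has_derivative_mult[OF Suc has_derivative_ident])
  then show ?case
    by (simp add: power_deriv_Suc[abs_def] power_Suc2 del: power_Suc)
qed

lemma norm_power_deriv_le:
  fixes w :: "'a::real_normed_algebra_1"
  assumes "norm w \<le> r"
  shows "norm (power_deriv n w h) \<le> real n * r ^ (n - 1) * norm h"
proof -
  have r: "r \<ge> 0" using assms norm_ge_zero[of w] by linarith
  have "norm (power_deriv n w h) \<le> (\<Sum>k<n. r ^ (n - 1) * norm h)"
    unfolding power_deriv_def
  proof (rule order_trans[OF norm_sum], rule sum_mono)
    fix k assume k: "k \<in> {..<n}"
    have pw: "norm (w ^ m) \<le> r ^ m" for m
      by (rule order_trans[OF norm_power_ineq power_mono]) (use assms in auto)
    have "norm (w ^ k * h * w ^ (n - 1 - k)) \<le> norm (w ^ k) * norm h * norm (w ^ (n - 1 - k))"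
      by (rule order_trans[OF norm_mult_ineq mult_right_mono[OF norm_mult_ineq]]) simp
    also have "\<dots> \<le> r ^ k * norm h * r ^ (n - 1 - k)"
      using r by (intro mult_mono pw) auto
    also have "\<dots> = r ^ (k + (n - 1 - k)) * norm h"
      by (simp add: power_add)
    also have "k + (n - 1 - k) = n - 1" using k by auto
    finally show "norm (w ^ k * h * w ^ (n - 1 - k)) \<le> r ^ (n - 1) * norm h" .
  qed
  then show ?thesis by simp
qed

text \<open>
  The majorant for the M-test: comparison of \<open>\<bar>c\<^sub>n\<bar> \<le> B / R\<^sup>n\<close> with the differentiated geometric
  series in \<open>r / R < 1\<close>. Bounded \<open>\<bar>c\<^sub>n\<bar> R\<^sup>n\<close> is all that convergence at one point provides, as it
  need not be absolute there.
\<close>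

lemma summable_deriv_majorant:
  fixes c :: "nat \<Rightarrow> 'a::real_normed_vector"
  assumes bound: "\<And>n. norm (c n) * R ^ n \<le> B" and r: "0 \<le> r" "r < R"
  shows "summable (\<lambda>n. norm (c n) * (real n * r ^ (n - 1)))"
proof -
  have R: "R > 0" using r by simp
  have B: "B \<ge> 0" using bound[of 0] by (rule order_trans[rotated]) simp
  have "summable (\<lambda>n. B / R * (real (Suc n) * (r / R) ^ n))"
    using geometric_deriv_sums[of "r / R"] r by (intro summable_mult) (auto simp: sums_iff)
  then have "summable (\<lambda>n. norm (c (Suc n)) * (real (Suc n) * r ^ (Suc n - 1)))"
  proof (rule summable_comparison_test'[where N = 0])
    fix n :: nat
    have "norm (c (Suc n)) * (real (Suc n) * r ^ n) * (R ^ Suc n)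
        = norm (c (Suc n)) * R ^ Suc n * (real (Suc n) * r ^ n)" by (simp add: ac_simps)
    also have "\<dots> \<le> B * (real (Suc n) * r ^ n)"
      using bound[of "Suc n"] r by (intro mult_right_mono) auto
    finally have "norm (c (Suc n)) * (real (Suc n) * r ^ n) \<le> B * (real (Suc n) * r ^ n) / R ^ Suc n"
      using R by (simp add: pos_le_divide_eq)
    also have "\<dots> = B / R * (real (Suc n) * (r / R) ^ n)"
      by (simp add: power_divide)
    finally show "norm (norm (c (Suc n)) * (real (Suc n) * r ^ (Suc n - 1)))
        \<le> B / R * (real (Suc n) * (r / R) ^ n)"
      using r by simp
  qed
  then show ?thesis
    by (subst summable_Suc_iff[symmetric])
qed

lemma summable_power_deriv:
  fixes c :: "nat \<Rightarrow> 'a::{real_normed_algebra_1, banach}"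
  assumes "\<And>n. norm (c n) * R ^ n \<le> B" and "norm w < R"
  shows "summable (\<lambda>n. c n * power_deriv n w h)"
proof (rule summable_comparison_test'[where N = 0])
  show "summable (\<lambda>n. norm (c n) * (real n * norm w ^ (n - 1)) * norm h)"
    by (intro summable_mult2 summable_deriv_majorant[OF assms(1)]) (use assms in auto)
  show "norm (c n * power_deriv n w h) \<le> norm (c n) * (real n * norm w ^ (n - 1)) * norm h" for n
    using order_trans[OF norm_mult_ineq
        mult_left_mono[OF norm_power_deriv_le[OF order_refl] norm_ge_zero], of "c n" n w h]
    by (simp add: mult.assoc)
qed

text \<open>
  The formal derivative of the series is its derivative in direction \<open>1\<close>, which commutes with \<open>w\<close>.
\<close>

lemma summable_power_series_termwise_deriv:
  fixes c :: "nat \<Rightarrow> 'a::{real_normed_algebra_1, banach}"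
  assumes "\<And>n. norm (c n) * R ^ n \<le> B" and "norm w < R"
  shows "summable (\<lambda>n. of_nat n * c n * w ^ (n - 1))"
proof -
  have "power_deriv n w 1 = of_nat n * w ^ (n - 1)" for n
  proof -
    have "power_deriv n w 1 = (\<Sum>k<n. w ^ (n - 1))"
      unfolding power_deriv_def by (rule sum.cong) (auto simp flip: power_add)
    then show ?thesis by simp
  qed
  then have "c n * power_deriv n w 1 = of_nat n * c n * w ^ (n - 1)" for n
    by (simp only: mult.assoc[symmetric] mult_of_nat_commute[of n "c n"])
  then show ?thesis
    using summable_power_deriv[OF assms, of 1] by simp
qed

text \<open>
  On a ball of radius \<open>r\<close> strictly between \<open>\<bar>w\<bar>\<close> and \<open>R\<close> the derivatives of the terms have
  operator norms bounded by a summable sequence, so their sum converges uniformly there as a series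
  of linear maps.
\<close>

theorem has_derivative_power_series_noncomm:
  fixes c :: "nat \<Rightarrow> 'a::{real_normed_algebra_1, banach}"
  assumes bound: "\<And>n. norm (c n) * R ^ n \<le> B" and w: "norm w < R"
  shows "((\<lambda>w. \<Sum>n. c n * w ^ n) has_derivative (\<lambda>h. \<Sum>n. c n * power_deriv n w h)) (at w)"
proof -
  obtain r where r: "norm w < r" "r < R" using dense[OF w] by blast
  have r0: "r > 0" using r(1) norm_ge_zero[of w] by linarith
  define M where "M = (\<lambda>n. norm (c n) * (real n * r ^ (n - 1)))"
  have sM: "summable M"
    unfolding M_def by (rule summable_deriv_majorant[OF bound]) (use r r0 in auto)
  have termle: "norm (c n * power_deriv n x h) \<le> M n * norm h" if "x \<in> ball 0 r" for n x h
    using order_trans[OF norm_mult_ineq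
        mult_left_mono[OF norm_power_deriv_le norm_ge_zero], of x r "c n" n h] that
    by (simp add: M_def mult.assoc)
  have "\<exists>G. \<forall>x\<in>ball 0 r. (\<lambda>n. c n * x ^ n) sums G x \<and>
      (G has_derivative (\<lambda>h. \<Sum>n. c n * power_deriv n x h)) (at x within ball 0 r)"
  proof (rule has_derivative_series)
    show "convex (ball (0::'a) r)" by simp
    show "((\<lambda>x. c n * x ^ n) has_derivative (\<lambda>h. c n * power_deriv n x h)) (at x within ball 0 r)"
      for n x
      by (rule has_derivative_mult_right[OF has_derivative_power_noncomm])
    show "(0::'a) \<in> ball 0 r" using r0 by simp
    show "(\<lambda>n. c n * 0 ^ n) sums c 0"
      using sums_finite[of "{0}" "\<lambda>n. c n * 0 ^ n"] by (simp add: power_0_left)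
    fix e :: real assume e: "e > 0"
    \<comment> \<open>The remainder of the derived series is at most the remainder of the majorant.\<close>
    obtain N where N: "\<And>n. n \<ge> N \<Longrightarrow> norm (\<Sum>i. M (i + n)) < e"
      using suminf_exist_split[OF e sM] by blast
    have "norm ((\<Sum>i<n. c i * power_deriv i x h) - (\<Sum>i. c i * power_deriv i x h)) \<le> e * norm h"
      if n: "n \<ge> N" and x: "x \<in> ball 0 r" for n x h
    proof -
      have s: "summable (\<lambda>i. c i * power_deriv i x h)"
        by (rule summable_power_deriv[OF bound]) (use x r in auto)
      have sm: "summable (\<lambda>i. M (i + n) * norm h)"
        by (intro summable_mult2 summable_ignore_initial_segment sM)
      have "norm ((\<Sum>i<n. c i * power_deriv i x h) - (\<Sum>i. c i * power_deriv i x h))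
          = norm (\<Sum>i. c (i + n) * power_deriv (i + n) x h)"
        by (subst suminf_minus_initial_segment[OF s]) (rule norm_minus_commute)
      also have "\<dots> \<le> (\<Sum>i. M (i + n) * norm h)"
        by (rule norm_suminf_le[OF termle[OF x] sm])
      also have "\<dots> = (\<Sum>i. M (i + n)) * norm h"
        by (rule suminf_mult2[symmetric]) (intro summable_ignore_initial_segment sM)
      also have "\<dots> \<le> e * norm h"
        using N[OF n] by (intro mult_right_mono) auto
      finally show ?thesis .
    qed
    then show "\<forall>\<^sub>F n in sequentially. \<forall>x\<in>ball 0 r. \<forall>h.
        norm ((\<Sum>i<n. c i * power_deriv i x h) - (\<Sum>i. c i * power_deriv i x h)) \<le> e * norm h"
      unfolding eventually_sequentially by blast
  qed
  then obtain G where G: "\<And>x. x \<in> ball 0 r \<Longrightarrow> (\<lambda>n. c n * x ^ n) sums G x"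
    "\<And>x. x \<in> ball 0 r \<Longrightarrow>
      (G has_derivative (\<lambda>h. \<Sum>n. c n * power_deriv n x h)) (at x within ball 0 r)"
    by blast
  have wr: "w \<in> ball 0 r" using r by simp
  then have "(G has_derivative (\<lambda>h. \<Sum>n. c n * power_deriv n w h)) (at w)"
    using G(2) by (metis at_within_open open_ball)
  then show ?thesis
    by (rule has_derivative_transform_within_open[OF _ open_ball wr]) (use G(1) sums_unique in blast)
qed

section \<open>Quaternions\<close>

text \<open>Termwise differentiation needs completeness, which finite dimension supplies.\<close>

instantiation quat :: euclidean_space
begin

definition "Basis_quat = {1, \<i>\<^sub>q, \<j>\<^sub>q, \<k>\<^sub>q}"

instance
proof
  show "(Basis :: quat set) \<noteq> {}" "finite (Basis :: quat set)"
    by (simp_all add: Basis_quat_def)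
  show "inner u v = (if u = v then 1 else 0)" if "u \<in> Basis" "v \<in> Basis" for u v :: quat
    using that
    by (auto simp: Basis_quat_def inner_quat_def quat_eq_iff quat_i_def quat_j_def quat_k_def)
  show "(\<forall>u\<in>Basis. inner x u = 0) \<longleftrightarrow> x = 0" for x :: quat
    by (simp add: Basis_quat_def inner_quat_def quat_eq_iff[of x] quat_i_def quat_j_def quat_k_def)
qed

end

lemma qcnj_one [simp]: "qcnj 1 = 1"
  by (simp add: quat_eq_iff)

lemma qcnj_mult: "qcnj (p * q) = qcnj q * qcnj p"
  by (simp add: quat_eq_iff algebra_simps)

lemma qcnj_power: "qcnj (q ^ n) = qcnj q ^ n"
  by (induction n) (simp_all add: qcnj_mult power_commutes)

lemma qcnj_inverse: "qcnj (inverse q) = inverse (qcnj q)"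
  by (simp add: quat_eq_iff)

lemma norm_qcnj [simp]: "norm (qcnj q) = norm q"
  by (simp add: norm_quat_def)

lemma qcnj_commute: "qcnj q * q = q * qcnj q"
  by (simp add: quat_eq_iff)

section \<open>The restricted HR derivative of a differentiable function\<close>

text \<open>
  The HR derivative as an operation on the total derivative \<open>D\<close> rather than on the function. It is
  linear over the quaternions acting by left multiplication, hence compatible with series with left
  coefficients.
\<close>

definition HR_part :: "(quat \<Rightarrow> quat) \<Rightarrow> quat" where
  "HR_part D = (1/4) *\<^sub>R (D 1 - D \<i>\<^sub>q * \<i>\<^sub>q - D \<j>\<^sub>q * \<j>\<^sub>q - D \<k>\<^sub>q * \<k>\<^sub>q)"

lemma has_derivative_imp_HR_deriv:
  assumes "(f has_derivative D) (at q)"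
  shows "has_qpartials f q" and "HR_deriv f q = HR_part D"
proof -
  have *: "((\<lambda>t::real. f (q + t *\<^sub>R u)) has_vector_derivative D u) (at 0)" for u
  proof -
    have "((\<lambda>t::real. q + t *\<^sub>R u) has_derivative (\<lambda>t. t *\<^sub>R u)) (at 0)"
      by (auto intro!: derivative_eq_intros)
    from has_derivative_compose[OF this, of f D] assms
    have "((\<lambda>t::real. f (q + t *\<^sub>R u)) has_derivative (\<lambda>t. D (t *\<^sub>R u))) (at 0)"
      by simp
    then show ?thesis
      by (simp add: has_vector_derivative_def linear_scale[OF has_derivative_linear[OF assms]])
  qed
  show "has_qpartials f q"
    unfolding has_qpartials_def
    using * by (blast intro: differentiableI_vector)
  show "HR_deriv f q = HR_part D"
    by (simp add: HR_deriv_def HR_part_def qpartial_def vector_derivative_at[OF *])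
qed

lemma HR_part_add: "HR_part (\<lambda>h. D h + E h) = HR_part D + HR_part E"
  by (simp add: HR_part_def algebra_simps flip: scaleR_add_right)

lemma HR_part_sum: "HR_part (\<lambda>h. \<Sum>k\<in>A. D k h) = (\<Sum>k\<in>A. HR_part (D k))"
  by (simp add: HR_part_def sum_distrib_right sum_subtractf flip: scaleR_sum_right)

lemma HR_part_mult_left: "HR_part (\<lambda>h. c * D h) = c * HR_part D"
  by (simp add: HR_part_def algebra_simps)

lemma HR_part_sums:
  assumes "\<And>h. (\<lambda>n. D n h) sums E h"
  shows "(\<lambda>n. HR_part (D n)) sums HR_part E"
  unfolding HR_part_def by (intro sums_scaleR_right sums_diff sums_mult2 assms)

text \<open>
  For \<open>p = 1\<close> this is the identity \<open>s - \<i>\<^sub>q s \<i>\<^sub>q - \<j>\<^sub>q s \<j>\<^sub>q - \<k>\<^sub>q s \<k>\<^sub>q = 2 (s + s\<^sup>*)\<close>: the sum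
  cancels the vector part of \<open>s\<close>, since each unit commutes with its own component and anticommutes
  with the other two. It is the source of the conjugate in the theorem.
\<close>

lemma HR_part_sandwich: "HR_part (\<lambda>h. p * h * s) = (1/2) *\<^sub>R (p * (s + qcnj s))"
proof -
  have "HR_part (\<lambda>h. h * s) = (1/2) *\<^sub>R (s + qcnj s)"
    by (simp add: HR_part_def quat_eq_iff quat_i_def quat_j_def quat_k_def)
  then show ?thesis
    using HR_part_mult_left[of p "\<lambda>h. h * s"] by (simp add: mult.assoc)
qed

text \<open>
  The factorization of \<open>x\<^sup>n - y\<^sup>n\<close> for two commuting elements of a ring that need not be
  commutative, such as a quaternion and its conjugate.
\<close>

lemma power_diff_commuting:
  fixes x y :: "'a::ring_1"
  assumes "x * y = y * x"
  shows "(\<Sum>k<n. x ^ k * y ^ (n - 1 - k)) * (x - y) = x ^ n - y ^ n"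
proof (induction n)
  case (Suc n)
  have "(\<Sum>k<n. x ^ k * y ^ (n - k)) = (\<Sum>k<n. x ^ k * y ^ (n - 1 - k)) * y"
    unfolding sum_distrib_right
  proof (rule sum.cong)
    fix k assume "k \<in> {..<n}"
    then have "n - k = Suc (n - 1 - k)" by auto
    then show "x ^ k * y ^ (n - k) = x ^ k * y ^ (n - 1 - k) * y"
      by (simp only: power_Suc2 mult.assoc)
  qed simp
  then have "(\<Sum>k<Suc n. x ^ k * y ^ (Suc n - 1 - k)) * (x - y)
      = (\<Sum>k<n. x ^ k * y ^ (n - 1 - k)) * (y * (x - y)) + x ^ n * (x - y)"
    by (simp add: distrib_right mult.assoc)
  also have "y * (x - y) = (x - y) * y"
    by (simp add: algebra_simps assms)
  also have "(\<Sum>k<n. x ^ k * y ^ (n - 1 - k)) * ((x - y) * y) = (x ^ n - y ^ n) * y"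
    by (simp only: Suc.IH flip: mult.assoc)
  finally show ?case
    by (simp add: algebra_simps power_Suc2 del: power_Suc)
qed simp

lemma mult_eq_imp_eq_mult_inverse:
  fixes d :: "'a::division_ring"
  assumes "s * d = r" "d \<noteq> 0"
  shows "s = r * inverse d"
  using assms by (auto simp: mult.assoc)

text \<open>
  In \<open>s + s\<^sup>*\<close> with \<open>s\<close> a power of \<open>z\<close>, the summand \<open>s\<close> completes \<open>z\<^sup>k\<close> to the same power for every
  \<open>k\<close>, while \<open>s\<^sup>*\<close> produces the geometric sum in \<open>z\<close> and \<open>z\<^sup>*\<close>.
\<close>

lemma HR_part_power_deriv:
  assumes "z \<noteq> qcnj z"
  shows "HR_part (power_deriv n z) =
    (1/2) *\<^sub>R (of_nat n * z ^ (n - 1) + (z ^ n - qcnj z ^ n) * inverse (z - qcnj z))"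
proof -
  have "HR_part (power_deriv n z) = (\<Sum>k<n. (1/2) *\<^sub>R (z ^ k * (z ^ (n - 1 - k) + qcnj z ^ (n - 1 - k))))"
    by (simp add: power_deriv_def[abs_def] HR_part_sum HR_part_sandwich qcnj_power)
  also have "\<dots> = (1/2) *\<^sub>R ((\<Sum>k<n. z ^ k * z ^ (n - 1 - k)) + (\<Sum>k<n. z ^ k * qcnj z ^ (n - 1 - k)))"
    by (simp add: scaleR_sum_right sum.distrib distrib_left scaleR_add_right)
  also have "(\<Sum>k<n. z ^ k * z ^ (n - 1 - k)) = (\<Sum>k<n. z ^ (n - 1))"
    by (rule sum.cong) (auto simp flip: power_add)
  also have "(\<Sum>k<n. z ^ k * qcnj z ^ (n - 1 - k)) = (z ^ n - qcnj z ^ n) * inverse (z - qcnj z)"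
    by (rule mult_eq_imp_eq_mult_inverse[OF power_diff_commuting]) (use assms in \<open>auto simp: qcnj_commute\<close>)
  finally show ?thesis by simp
qed

text \<open>
  The direction \<open>- (w h w)\<close> is the derivative of the inverse, so this computes the HR derivative of
  \<open>z \<mapsto> w\<^sup>n\<close>. The outer factors \<open>w\<close> raise the exponents on both sides of \<open>h\<close> by one, so the geometric
  sum in \<open>w\<close> and \<open>w\<^sup>*\<close> gets an extra factor \<open>w w\<^sup>*\<close>. That factor converts the denominator
  \<open>w - w\<^sup>*\<close> into \<open>z - z\<^sup>*\<close> up to sign, because \<open>w - w\<^sup>* = - w w\<^sup>* (z - z\<^sup>*)\<close>.
\<close>

lemma HR_part_power_deriv_inverse:
  fixes z :: quat
  assumes "z \<noteq> qcnj z"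
  defines "w \<equiv> inverse z"
  shows "HR_part (\<lambda>h. power_deriv n w (- (w * h * w))) =
    (1/2) *\<^sub>R (- (of_nat n * w ^ (n + 1)) + (w ^ n - qcnj w ^ n) * inverse (z - qcnj z))"
proof -
  define S where "S = (\<Sum>k<n. w ^ k * qcnj w ^ (n - 1 - k))"
  have z0: "z \<noteq> 0" "qcnj z \<noteq> 0"
    using assms by (metis norm_qcnj norm_eq_zero)+
  have zw: "w * z = 1" "z * w = 1" using z0 by (simp_all add: w_def)
  have zw': "qcnj w * qcnj z = 1" using z0 by (simp add: w_def qcnj_inverse)
  have cw: "w * qcnj w = qcnj w * w" by (simp add: qcnj_commute)
  have czw: "qcnj w * z = z * qcnj w"
    by (metis cw mult.assoc mult.left_neutral mult.right_neutral zw)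
  have "power_deriv n w (- (w * h * w)) = - (\<Sum>k<n. w ^ Suc k * h * w ^ (n - k))" for h
    unfolding power_deriv_def sum_negf[symmetric]
  proof (rule sum.cong)
    fix k assume "k \<in> {..<n}"
    then have "n - k = Suc (n - 1 - k)" by auto
    then show "w ^ k * - (w * h * w) * w ^ (n - 1 - k) = - (w ^ Suc k * h * w ^ (n - k))"
      by (simp only: power_Suc[of w "n - 1 - k"] power_Suc2[of w k] mult.assoc
          mult_minus_left mult_minus_right)
  qed simp
  then have "HR_part (\<lambda>h. power_deriv n w (- (w * h * w)))
      = HR_part (\<lambda>h. - 1 * (\<Sum>k<n. w ^ Suc k * h * w ^ (n - k)))"
    by simp
  also have "\<dots> = - (\<Sum>k<n. (1/2) *\<^sub>R (w ^ Suc k * (w ^ (n - k) + qcnj w ^ (n - k))))"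
    by (simp only: HR_part_mult_left HR_part_sum HR_part_sandwich qcnj_power) simp
  also have "\<dots> = (1/2) *\<^sub>R (- (\<Sum>k<n. w ^ Suc k * w ^ (n - k)) - (\<Sum>k<n. w ^ Suc k * qcnj w ^ (n - k)))"
    by (simp only: scaleR_sum_right[symmetric] sum.distrib distrib_left scaleR_add_right) 
       (simp add: algebra_simps)
  also have "(\<Sum>k<n. w ^ Suc k * w ^ (n - k)) = (\<Sum>k<n. w ^ (n + 1))"
    by (rule sum.cong) (auto simp del: power_Suc simp flip: power_add)
  also have "(\<Sum>k<n. w ^ Suc k * qcnj w ^ (n - k)) = w * S * qcnj w"
    unfolding S_def sum_distrib_left sum_distrib_right
  proof (rule sum.cong)
    fix k assume "k \<in> {..<n}"
    then have "n - k = Suc (n - 1 - k)" by auto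
    then show "w ^ Suc k * qcnj w ^ (n - k) = w * (w ^ k * qcnj w ^ (n - 1 - k)) * qcnj w"
      by (simp only: power_Suc2[of "qcnj w"] power_Suc[of w] mult.assoc)
  qed simp
  also have "w * S * qcnj w = (- (w ^ n - qcnj w ^ n)) * inverse (z - qcnj z)"
  proof (rule mult_eq_imp_eq_mult_inverse)
    \<comment> \<open>Both sides equal \<open>qcnj w * z - 1\<close>.\<close>
    have "qcnj w * (z - qcnj z) = - ((w - qcnj w) * z)"
      using czw zw zw' by (simp add: algebra_simps)
    then have "w * S * qcnj w * (z - qcnj z) = - (w * (S * (w - qcnj w)) * z)"
      by (simp add: mult.assoc)
    also have "S * (w - qcnj w) = w ^ n - qcnj w ^ n"
      unfolding S_def by (rule power_diff_commuting[OF cw])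
    also have "w * (w ^ n - qcnj w ^ n) = (w ^ n - qcnj w ^ n) * w"
      using power_commuting_commutes[OF cw[symmetric], of n] by (simp add: algebra_simps power_commutes)
    also have "- ((w ^ n - qcnj w ^ n) * w * z) = - (w ^ n - qcnj w ^ n)"
      by (simp add: mult.assoc zw)
    finally show "w * S * qcnj w * (z - qcnj z) = - (w ^ n - qcnj w ^ n)" .
  qed (use assms in simp)
  finally show ?thesis
    by (simp only: mult_minus_left diff_minus_eq_add sum_constant card_lessThan)
qed

section \<open>The two halves of a Laurent series\<close>

text \<open>
  In this lemma and the next one the two sums \<open>s\<close> and \<open>s'\<close> are the values of the series at a point
  and at its conjugate. Since the HR derivative is compatible with series, it suffices to sum the
  formula for single powers.
\<close>

lemma power_series_HR_derivative:
  fixes c :: "nat \<Rightarrow> quat"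
  assumes bound: "\<And>n. norm (c n) * R ^ n \<le> B" and z: "norm z < R" and nonreal: "z \<noteq> qcnj z"
    and sums: "(\<lambda>n. c n * z ^ n) sums s" "(\<lambda>n. c n * qcnj z ^ n) sums s'"
  shows "HR_part (\<lambda>h. \<Sum>n. c n * power_deriv n z h) =
    (1/2) *\<^sub>R ((\<Sum>n. of_nat n * c n * z ^ (n - 1)) + (s - s') * inverse (z - qcnj z))"
proof (rule sums_unique2)
  show "(\<lambda>n. HR_part (\<lambda>h. c n * power_deriv n z h)) sums HR_part (\<lambda>h. \<Sum>n. c n * power_deriv n z h)"
    by (intro HR_part_sums summable_sums summable_power_deriv[OF bound z])
  have "HR_part (\<lambda>h. c n * power_deriv n z h) = (1/2) *\<^sub>R (of_nat n * c n * z ^ (n - 1)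
      + (c n * z ^ n - c n * qcnj z ^ n) * inverse (z - qcnj z))" for n
    by (simp add: HR_part_mult_left HR_part_power_deriv[OF nonreal] distrib_left
        right_diff_distrib mult.assoc[symmetric] mult_of_nat_commute[of n "c n"])
  moreover have "(\<lambda>n. (1/2) *\<^sub>R (of_nat n * c n * z ^ (n - 1)
      + (c n * z ^ n - c n * qcnj z ^ n) * inverse (z - qcnj z))) sums
    ((1/2) *\<^sub>R ((\<Sum>n. of_nat n * c n * z ^ (n - 1)) + (s - s') * inverse (z - qcnj z)))"
    by (intro sums_scaleR_right sums_add sums_mult2 sums_diff sums summable_sums
        summable_power_series_termwise_deriv[OF bound z])
  ultimately show "(\<lambda>n. HR_part (\<lambda>h. c n * power_deriv n z h)) sums
    ((1/2) *\<^sub>R ((\<Sum>n. of_nat n * c n * z ^ (n - 1)) + (s - s') * inverse (z - qcnj z)))"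
    by simp
qed

lemma power_series_inverse_HR_derivative:
  fixes c :: "nat \<Rightarrow> quat" and z :: quat
  defines "w \<equiv> inverse z"
  assumes bound: "\<And>n. norm (c n) * R ^ n \<le> B" and w: "norm w < R" and nonreal: "z \<noteq> qcnj z"
    and sums: "(\<lambda>n. c n * w ^ n) sums s" "(\<lambda>n. c n * qcnj w ^ n) sums s'"
  shows "summable (\<lambda>n. of_nat n * c n * w ^ (n + 1))"
    and "HR_part (\<lambda>h. \<Sum>n. c n * power_deriv n w (- (w * h * w))) =
    (1/2) *\<^sub>R (- (\<Sum>n. of_nat n * c n * w ^ (n + 1)) + (s - s') * inverse (z - qcnj z))"
proof -
  have "of_nat n * c n * w ^ (n - 1) * w ^ 2 = of_nat n * c n * w ^ (n + 1)" for n
    by (cases n) (simp_all add: mult.assoc flip: power_add)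
  then show summ: "summable (\<lambda>n. of_nat n * c n * w ^ (n + 1))"
    using summable_mult2[OF summable_power_series_termwise_deriv[OF bound w], of "w ^ 2"] by simp
  show "HR_part (\<lambda>h. \<Sum>n. c n * power_deriv n w (- (w * h * w))) =
    (1/2) *\<^sub>R (- (\<Sum>n. of_nat n * c n * w ^ (n + 1)) + (s - s') * inverse (z - qcnj z))"
  proof (rule sums_unique2)
    show "(\<lambda>n. HR_part (\<lambda>h. c n * power_deriv n w (- (w * h * w)))) sums
        HR_part (\<lambda>h. \<Sum>n. c n * power_deriv n w (- (w * h * w)))"
      by (intro HR_part_sums summable_sums summable_power_deriv[OF bound w])
    have "HR_part (\<lambda>h. c n * power_deriv n w (- (w * h * w))) =
        (1/2) *\<^sub>R (- (of_nat n * c n * w ^ (n + 1))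
          + (c n * w ^ n - c n * qcnj w ^ n) * inverse (z - qcnj z))" for n
      by (simp add: HR_part_mult_left HR_part_power_deriv_inverse[OF nonreal, folded w_def]
          distrib_left right_diff_distrib mult.assoc[symmetric] mult_of_nat_commute[of n "c n"]
          del: power_Suc)
    moreover have "(\<lambda>n. (1/2) *\<^sub>R (- (of_nat n * c n * w ^ (n + 1))
          + (c n * w ^ n - c n * qcnj w ^ n) * inverse (z - qcnj z))) sums
        ((1/2) *\<^sub>R (- (\<Sum>n. of_nat n * c n * w ^ (n + 1)) + (s - s') * inverse (z - qcnj z)))"
      by (intro sums_scaleR_right sums_add sums_mult2 sums_diff sums_minus sums summable_sums summ)
    ultimately show "(\<lambda>n. HR_part (\<lambda>h. c n * power_deriv n w (- (w * h * w)))) sums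
        ((1/2) *\<^sub>R (- (\<Sum>n. of_nat n * c n * w ^ (n + 1)) + (s - s') * inverse (z - qcnj z)))"
      by simp
  qed
qed

lemma summable_imp_coeff_bound:
  fixes c :: "nat \<Rightarrow> 'a::real_normed_div_algebra"
  assumes "summable (\<lambda>n. c n * x ^ n)"
  obtains B where "\<And>n. norm (c n) * norm x ^ n \<le> B"
  using summable_imp_Bseq[OF assms] unfolding Bseq_def by (auto simp: norm_mult norm_power)

theorem theorem1:
  fixes f g :: "quat \<Rightarrow> quat" and a :: "int \<Rightarrow> quat" and q0 q :: quat and R1 R2 :: real
  assumes "R1 > 0" and "R2 > 0"
    and series: "\<And>z. R1 \<le> norm z \<Longrightarrow> norm z \<le> R2 \<Longrightarrow>
      bi_summable (\<lambda>n. a n * z powi n) \<and> g z = bi_suminf (\<lambda>n. a n * z powi n)"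
    and f_eq: "\<And>p. R1 \<le> norm (p - q0) \<Longrightarrow> norm (p - q0) \<le> R2 \<Longrightarrow> f p = g (p - q0)"
    and annulus: "R1 < norm (q - q0)" "norm (q - q0) < R2"
    and nonreal: "q - q0 \<noteq> qcnj (q - q0)"
  shows "has_qpartials f q
    \<and> bi_summable (\<lambda>n. of_int n * a n * (q - q0) powi (n - 1))
    \<and> HR_deriv f q = (1/2) *\<^sub>R
        (bi_suminf (\<lambda>n. of_int n * a n * (q - q0) powi (n - 1))
         + (g (q - q0) - g (qcnj (q - q0))) * inverse ((q - q0) - qcnj (q - q0)))"
proof -
  define z where "z = q - q0"
  define w where "w = inverse z"
  define b where "b = (\<lambda>n. a (int n))"
  \<comment> \<open>The principal part as a power series in the inverse; the constant term belongs to \<open>b\<close>.\<close>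
  define c where "c = (\<lambda>n. if n = 0 then 0 else a (- int n))"
  have z: "R1 < norm z" "norm z < R2" "z \<noteq> qcnj z"
    using annulus nonreal by (simp_all add: z_def)
  have z0: "z \<noteq> 0" using z(1) \<open>R1 > 0\<close> by auto
  have powi_neg: "x powi (- int (Suc n)) = inverse x ^ Suc n" for x :: quat and n
    by (simp only: power_int_minus power_int_of_nat power_inverse)
  have neg_term: "a (- int (Suc n)) * x powi (- int (Suc n)) = c (Suc n) * inverse x ^ Suc n"
    for x n unfolding powi_neg by (simp add: c_def)
  have parts: "summable (\<lambda>n. b n * x ^ n)" "summable (\<lambda>n. c n * inverse x ^ n)"
    "g x = (\<Sum>n. b n * x ^ n) + (\<Sum>n. c n * inverse x ^ n)"
    if x: "R1 \<le> norm x" "norm x \<le> R2" for x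
  proof -
    note s = series[OF x, unfolded bi_summable_def bi_suminf_def neg_term power_int_of_nat]
    show "summable (\<lambda>n. b n * x ^ n)" using s by (simp add: b_def)
    show c: "summable (\<lambda>n. c n * inverse x ^ n)"
      using s by (subst summable_Suc_iff[symmetric]) blast
    have "(\<Sum>n. c (Suc n) * inverse x ^ Suc n) = (\<Sum>n. c n * inverse x ^ n)"
      using suminf_split_head[OF c] by (simp add: c_def)
    then show "g x = (\<Sum>n. b n * x ^ n) + (\<Sum>n. c n * inverse x ^ n)"
      using s by (simp add: b_def)
  qed
  \<comment> \<open>The real points \<open>R2\<close> and \<open>R1\<close> on the boundary spheres give the coefficient bounds.\<close>
  have "summable (\<lambda>n. b n * of_real R2 ^ n)"
    by (rule parts(1)) (use z \<open>R2 > 0\<close> in auto)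
  from summable_imp_coeff_bound[OF this] obtain B where B: "\<And>n. norm (b n) * R2 ^ n \<le> B"
    using \<open>R2 > 0\<close> by auto
  have "summable (\<lambda>n. c n * inverse (of_real R1) ^ n)"
    by (rule parts(2)) (use z \<open>R1 > 0\<close> in auto)
  from summable_imp_coeff_bound[OF this] obtain C where C: "\<And>n. norm (c n) * inverse R1 ^ n \<le> C"
    using \<open>R1 > 0\<close> by (auto simp: norm_inverse)
  have w: "norm w < inverse R1"
    using less_imp_inverse_less[OF z(1) \<open>R1 > 0\<close>] by (simp add: w_def norm_inverse)

  define P where "P = (\<lambda>x. \<Sum>n. b n * x ^ n)"
  define N where "N = (\<lambda>x. \<Sum>n. c n * x ^ n)"
  define DP where "DP = (\<lambda>h. \<Sum>n. b n * power_deriv n z h)"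
  define DN where "DN = (\<lambda>h. \<Sum>n. c n * power_deriv n w (- (w * h * w)))"
  have dP: "(P has_derivative DP) (at z)"
    unfolding P_def DP_def by (rule has_derivative_power_series_noncomm[OF B z(2)])
  have dN: "((\<lambda>x. N (inverse x)) has_derivative DN) (at z)"
    using has_derivative_compose[OF has_derivative_inverse'[OF z0]
        has_derivative_power_series_noncomm[OF C w, unfolded w_def]]
    by (simp add: N_def DN_def w_def)
  have shift: "((\<lambda>p. p - q0) has_derivative (\<lambda>h. h)) (at q)"
    by (auto intro!: derivative_eq_intros)
  have "((\<lambda>p. P (p - q0) + N (inverse (p - q0))) has_derivative (\<lambda>h. DP h + DN h)) (at q)"
    using has_derivative_compose[OF shift, of "\<lambda>x. P x + N (inverse x)"]
      has_derivative_add[OF dP dN] by (simp add: z_def)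
  then have df: "(f has_derivative (\<lambda>h. DP h + DN h)) (at q)"
  proof (rule has_derivative_transform_within_open)
    show "open {p. R1 < norm (p - q0) \<and> norm (p - q0) < R2}"
      by (intro open_Collect_conj open_Collect_less continuous_intros)
    show "P (p - q0) + N (inverse (p - q0)) = f p"
      if "p \<in> {p. R1 < norm (p - q0) \<and> norm (p - q0) < R2}" for p
      using that f_eq[of p] parts(3)[of "p - q0"] by (simp add: P_def N_def)
  qed (use annulus in simp)

  have wc: "qcnj w = inverse (qcnj z)" by (simp add: w_def qcnj_inverse)
  have g: "g z = P z + N w" "g (qcnj z) = P (qcnj z) + N (qcnj w)"
    using parts(3)[of z, folded w_def] parts(3)[of "qcnj z", folded wc] z
    by (simp_all add: P_def N_def)
  have sP: "(\<lambda>n. b n * z ^ n) sums P z" "(\<lambda>n. b n * qcnj z ^ n) sums P (qcnj z)"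
    using parts(1)[of z] parts(1)[of "qcnj z"] z by (simp_all add: P_def summable_sums)
  have sN: "(\<lambda>n. c n * w ^ n) sums N w" "(\<lambda>n. c n * qcnj w ^ n) sums N (qcnj w)"
    using parts(2)[of z, folded w_def] parts(2)[of "qcnj z", folded wc] z
    by (simp_all add: N_def summable_sums)
  note neg = power_series_inverse_HR_derivative[OF C w[unfolded w_def] z(3) sN[unfolded w_def],
      folded w_def]

  define u where "u = (\<lambda>n. of_int n * a n * z powi (n - 1))"
  have u_pos: "u (int n) = of_nat n * b n * z ^ (n - 1)" for n
    by (cases n) (simp_all add: u_def b_def)
  \<comment> \<open>The exponent \<open>- Suc n - 1\<close> matches the \<open>w ^ (m + 1)\<close> that differentiating \<open>w ^ m\<close> produces,
    with \<open>m = Suc n\<close>.\<close>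
  have u_neg: "u (- int (Suc n)) = - (of_nat (Suc n) * c (Suc n) * w ^ (Suc n + 1))" for n
  proof -
    have "- int (Suc n) - 1 = - int (Suc (Suc n))" by simp
    then have "u (- int (Suc n)) = of_int (- int (Suc n)) * a (- int (Suc n)) * inverse z ^ Suc (Suc n)"
      unfolding u_def using powi_neg[of z "Suc n"] by (simp only:)
    then show ?thesis by (simp add: c_def w_def del: of_nat_Suc power_Suc)
  qed
  have su_pos: "summable (\<lambda>n. u (int n))"
    unfolding u_pos by (rule summable_power_series_termwise_deriv[OF B z(2)])
  have su_neg: "summable (\<lambda>n. u (- int (Suc n)))"
    unfolding u_neg by (intro summable_minus) (use neg(1) in \<open>subst summable_Suc_iff\<close>)
  have bi: "bi_suminf u = (\<Sum>n. of_nat n * b n * z ^ (n - 1)) - (\<Sum>n. of_nat n * c n * w ^ (n + 1))"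
  proof -
    have sc: "summable (\<lambda>n. of_nat (Suc n) * c (Suc n) * w ^ (Suc n + 1))"
      using neg(1) by (subst summable_Suc_iff)
    have "(\<Sum>n. of_nat (Suc n) * c (Suc n) * w ^ (Suc n + 1)) = (\<Sum>n. of_nat n * c n * w ^ (n + 1))"
      using suminf_split_head[OF neg(1)] by simp
    then show ?thesis
      unfolding bi_suminf_def u_pos u_neg suminf_minus[OF sc] by simp
  qed
  have "HR_deriv f q = HR_part DP + HR_part DN"
    by (simp add: has_derivative_imp_HR_deriv(2)[OF df] HR_part_add)
  also have "\<dots> = (1/2) *\<^sub>R (bi_suminf u + (g z - g (qcnj z)) * inverse (z - qcnj z))"
    unfolding DP_def DN_def neg(2) power_series_HR_derivative[OF B z(2,3) sP] bi g
    by (simp add: algebra_simps)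
  finally show ?thesis
    using has_derivative_imp_HR_deriv(1)[OF df] su_pos su_neg
    by (simp add: bi_summable_def u_def z_def)
qed

end
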